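(* Let $\kappa$ be a field and $G$ an infinite group having a non-trivial element of finite order. Let $W\subseteq G\times G$ be such that $C_{(z,z^{-1})}\cap W=\varnothing$ for all $z\in G$, and let $\sigma_W$ be the lateral factor set generated by $W$. If $|W|<|G|$, then $\Omega_{\sigma_W}$ has no isolated points, and consequently the spectral partial action $\hat\theta$ of $G$ on $\Omega_{\sigma_W}$ is topologically free.
   Context: For $a,b\in G$, $C_{(a,b)}:=\{(a,b),(b^{-1}a^{-1},a),(b,b^{-1}a^{-1}),(b^{-1},a^{-1}),(a^{-1},ab),(ab,b^{-1})\}$. The lateral factor set generated by $W$ is $\sigma_W:G\times G\to\kappa$, $\sigma_W(a,b)=0$ if $C_{(a,b)}\cap W\neq\varnothing$ and $\sigma_W(a,b)=1$ otherwise (it is a factor set of a partial projective representation of $G$ over $\kappa$). For a factor set $\sigma:G\times G\to\kappa$: let $\Omega=\{\xi\subseteq G:1\in\xi\}$, identified with $\prod_{g\in G\setminus\{1\}}\{0,1\}$ and given the product topology. The $\sigma$-prohibitions of type I are the sets $\{h,hg,hgs\}$ with $h,g,s\in G$ and $\sigma(g,s)=0$; those of type II are the sets $\{h,hg,hgs,hgst\}$ with $h,g,s,t\in G$ and $\sigma(g,st)\sigma(s,t)\neq\sigma(g,s)\sigma(gs,t)$. $\mathcal{P}_\sigma$ is the set of all $\sigma$-prohibitions, and $\Omega_\sigma=\{\xi\in\Omega: V\nsubseteq\xi\text{ for all }V\in\mathcal{P}_\sigma\}$ with the subspace topology. The spectral partial action $\hat\theta$ of $G$ on $\Omega_\sigma$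 is given by the clopen sets $\hat D_g=\{\xi\in\Omega_\sigma:g\in\xi\}$ and the homeomorphisms $\hat\theta_g:\hat D_{g^{-1}}\to\hat D_g$, $\hat\theta_g(\xi)=g\xi$. A topological partial action $(\{X_g\},\{\theta_g:X_{g^{-1}}\to X_g\})$ of $G$ on a space $X$ is topologically free if for every $g\neq1_G$ the set $\{x\in X_{g^{-1}}:\theta_g(x)=x\}$ has empty interior. *)

theory Defs
  imports "HOL-Algebra.Coset" "HOL-Algebra.Ring" "HOL-Analysis.Analysis"
begin

section \<open>Lateral factor sets\<close>

definition lateral_class :: "('a, 'm) monoid_scheme \<Rightarrow> 'a \<Rightarrow> 'a \<Rightarrow> ('a \<times> 'a) set" where
  "lateral_class G a b =
    {(a, b),
     (inv\<^bsub>G\<^esub> b \<otimes>\<^bsub>G\<^esub> inv\<^bsub>G\<^esub> a, a),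
     (b, inv\<^bsub>G\<^esub> b \<otimes>\<^bsub>G\<^esub> inv\<^bsub>G\<^esub> a),
     (inv\<^bsub>G\<^esub> b, inv\<^bsub>G\<^esub> a),
     (inv\<^bsub>G\<^esub> a, a \<otimes>\<^bsub>G\<^esub> b),
     (a \<otimes>\<^bsub>G\<^esub> b, inv\<^bsub>G\<^esub> b)}"

definition lateral_factor_set ::
  "('a, 'm) monoid_scheme \<Rightarrow> ('k, 'n) ring_scheme \<Rightarrow> ('a \<times> 'a) set \<Rightarrow> 'a \<Rightarrow> 'a \<Rightarrow> 'k" where
  "lateral_factor_set G K W a b =
    (if lateral_class G a b \<inter> W \<noteq> {} then \<zero>\<^bsub>K\<^esub> else \<one>\<^bsub>K\<^esub>)"


section \<open>Prohibitions and the spectrum\<close>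

definition prohibitions_I ::
  "('a, 'm) monoid_scheme \<Rightarrow> ('k, 'n) ring_scheme \<Rightarrow> ('a \<Rightarrow> 'a \<Rightarrow> 'k) \<Rightarrow> 'a set set" where
  "prohibitions_I G K \<sigma> =
    {{h, h \<otimes>\<^bsub>G\<^esub> g, h \<otimes>\<^bsub>G\<^esub> g \<otimes>\<^bsub>G\<^esub> s} | h g s.
      h \<in> carrier G \<and> g \<in> carrier G \<and> s \<in> carrier G \<and> \<sigma> g s = \<zero>\<^bsub>K\<^esub>}"

definition prohibitions_II ::
  "('a, 'm) monoid_scheme \<Rightarrow> ('k, 'n) ring_scheme \<Rightarrow> ('a \<Rightarrow> 'a \<Rightarrow> 'k) \<Rightarrow> 'a set set" where
  "prohibitions_II G K \<sigma> =
    {{h, h \<otimes>\<^bsub>G\<^esub> g, h \<otimes>\<^bsub>G\<^esub> g \<otimes>\<^bsub>G\<^esub> s, h \<otimes>\<^bsub>G\<^esub> g \<otimes>\<^bsub>G\<^esub> s \<otimes>\<^bsub>G\<^esub> t} | h g s t.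
      h \<in> carrier G \<and> g \<in> carrier G \<and> s \<in> carrier G \<and> t \<in> carrier G \<and>
      \<sigma> g (s \<otimes>\<^bsub>G\<^esub> t) \<otimes>\<^bsub>K\<^esub> \<sigma> s t \<noteq> \<sigma> g s \<otimes>\<^bsub>K\<^esub> \<sigma> (g \<otimes>\<^bsub>G\<^esub> s) t}"

definition prohibitions ::
  "('a, 'm) monoid_scheme \<Rightarrow> ('k, 'n) ring_scheme \<Rightarrow> ('a \<Rightarrow> 'a \<Rightarrow> 'k) \<Rightarrow> 'a set set" where
  "prohibitions G K \<sigma> = prohibitions_I G K \<sigma> \<union> prohibitions_II G K \<sigma>"

definition Omega :: "('a, 'm) monoid_scheme \<Rightarrow> 'a set set" where
  "Omega G = {\<xi>. \<xi> \<subseteq> carrier G \<and> \<one>\<^bsub>G\<^esub> \<in> \<xi>}"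

text \<open>
  A set \<open>\<xi>\<close> in \<open>Omega G\<close> is identified with its indicator function on \<open>carrier G - {1}\<close>, with
  \<open>bool\<close> as the discrete two-point space; the topology is the product topology transported
  along this bijection.
\<close>

definition Omega_topology :: "('a, 'm) monoid_scheme \<Rightarrow> 'a set topology" where
  "Omega_topology G =
    pullback_topology (Omega G)
      (\<lambda>\<xi>. \<lambda>g\<in>carrier G - {\<one>\<^bsub>G\<^esub>}. g \<in> \<xi>)
      (product_topology (\<lambda>_. discrete_topology (UNIV :: bool set)) (carrier G - {\<one>\<^bsub>G\<^esub>}))"

definition Omega_sigma ::
  "('a, 'm) monoid_scheme \<Rightarrow> ('k, 'n) ring_scheme \<Rightarrow> ('a \<Rightarrow> 'a \<Rightarrow> 'k) \<Rightarrow> 'a set set" where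
  "Omega_sigma G K \<sigma> = {\<xi> \<in> Omega G. \<forall>V \<in> prohibitions G K \<sigma>. \<not> V \<subseteq> \<xi>}"

definition Omega_sigma_topology ::
  "('a, 'm) monoid_scheme \<Rightarrow> ('k, 'n) ring_scheme \<Rightarrow> ('a \<Rightarrow> 'a \<Rightarrow> 'k) \<Rightarrow> 'a set topology" where
  "Omega_sigma_topology G K \<sigma> = subtopology (Omega_topology G) (Omega_sigma G K \<sigma>)"


section \<open>Topological partial actions\<close>

text \<open>
  A partial action is given by its domains \<open>D g\<close> and by total functions \<open>\<theta> g\<close>, of which only
  the restriction to \<open>D (inv g)\<close> is meaningful.
\<close>

definition topological_partial_action ::
  "('a, 'm) monoid_scheme \<Rightarrow> 'x topology \<Rightarrow> ('a \<Rightarrow> 'x set) \<Rightarrow> ('a \<Rightarrow> 'x \<Rightarrow> 'x) \<Rightarrow> bool" where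
  "topological_partial_action G X D \<theta> \<longleftrightarrow>
    (\<forall>g \<in> carrier G. openin X (D g)) \<and>
    (\<forall>g \<in> carrier G.
      homeomorphic_map (subtopology X (D (inv\<^bsub>G\<^esub> g))) (subtopology X (D g)) (\<theta> g)) \<and>
    D \<one>\<^bsub>G\<^esub> = topspace X \<and>
    (\<forall>x \<in> topspace X. \<theta> \<one>\<^bsub>G\<^esub> x = x) \<and>
    (\<forall>g \<in> carrier G. \<forall>h \<in> carrier G. \<forall>x \<in> D (inv\<^bsub>G\<^esub> h). \<theta> h x \<in> D (inv\<^bsub>G\<^esub> g) \<longrightarrow>
      x \<in> D (inv\<^bsub>G\<^esub> (g \<otimes>\<^bsub>G\<^esub> h)) \<and> \<theta> (g \<otimes>\<^bsub>G\<^esub> h) x = \<theta> g (\<theta> h x))"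

definition topologically_free ::
  "('a, 'm) monoid_scheme \<Rightarrow> 'x topology \<Rightarrow> ('a \<Rightarrow> 'x set) \<Rightarrow> ('a \<Rightarrow> 'x \<Rightarrow> 'x) \<Rightarrow> bool" where
  "topologically_free G X D \<theta> \<longleftrightarrow>
    (\<forall>g \<in> carrier G. g \<noteq> \<one>\<^bsub>G\<^esub> \<longrightarrow>
      X interior_of {x \<in> D (inv\<^bsub>G\<^esub> g). \<theta> g x = x} = {})"

definition spectral_domain ::
  "('a, 'm) monoid_scheme \<Rightarrow> ('k, 'n) ring_scheme \<Rightarrow> ('a \<Rightarrow> 'a \<Rightarrow> 'k) \<Rightarrow> 'a \<Rightarrow> 'a set set" where
  "spectral_domain G K \<sigma> g = {\<xi> \<in> Omega_sigma G K \<sigma>. g \<in> \<xi>}"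

definition spectral_map :: "('a, 'm) monoid_scheme \<Rightarrow> 'a \<Rightarrow> 'a set \<Rightarrow> 'a set" where
  "spectral_map G g \<xi> = g <#\<^bsub>G\<^esub> \<xi>"


section \<open>The spectral partial action is a topological partial action\<close>

lemma topspace_Omega_topology: "topspace (Omega_topology G) = Omega G"
  by (auto simp: Omega_topology_def topspace_pullback_topology)

lemma topspace_Omega_sigma_topology:
  "topspace (Omega_sigma_topology G K \<sigma>) = Omega_sigma G K \<sigma>"
  by (auto simp: Omega_sigma_topology_def topspace_Omega_topology Omega_sigma_def)

lemma continuous_map_mem_Omega:
  assumes "x \<in> carrier G"
  shows "continuous_map (Omega_topology G) (discrete_topology (UNIV :: bool set)) (\<lambda>\<xi>. x \<in> \<xi>)"
proof (cases "x = \<one>\<^bsub>G\<^esub>")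
  case True
  show ?thesis
    by (rule continuous_map_eq[where f = "\<lambda>_. True"])
       (auto simp: True topspace_Omega_topology Omega_def)
next
  case False
  let ?I = "carrier G - {\<one>\<^bsub>G\<^esub>}"
  have x: "x \<in> ?I" using assms False by auto
  have "continuous_map (Omega_topology G) (discrete_topology (UNIV :: bool set))
      ((\<lambda>f. f x) \<circ> (\<lambda>\<xi>. \<lambda>g\<in>?I. g \<in> \<xi>))"
    unfolding Omega_topology_def
    by (intro continuous_map_pullback continuous_map_product_projection x)
  then show ?thesis
    using x by (simp add: comp_def)
qed

lemma mem_spectral_map:
  assumes "group G" "g \<in> carrier G" "\<xi> \<subseteq> carrier G" "k \<in> carrier G"
  shows "k \<in> spectral_map G g \<xi> \<longleftrightarrow> inv\<^bsub>G\<^esub> g \<otimes>\<^bsub>G\<^esub> k \<in> \<xi>"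
proof -
  interpret group G by fact
  have cancel: "inv\<^bsub>G\<^esub> g \<otimes>\<^bsub>G\<^esub> (g \<otimes>\<^bsub>G\<^esub> h) = h" "g \<otimes>\<^bsub>G\<^esub> (inv\<^bsub>G\<^esub> g \<otimes>\<^bsub>G\<^esub> h) = h"
    if "h \<in> carrier G" for h
    using that assms(2) by (simp_all flip: m_assoc)
  show ?thesis
  proof
    assume "k \<in> spectral_map G g \<xi>"
    then obtain h where "h \<in> \<xi>" "k = g \<otimes>\<^bsub>G\<^esub> h"
      by (auto simp: spectral_map_def l_coset_def)
    then show "inv\<^bsub>G\<^esub> g \<otimes>\<^bsub>G\<^esub> k \<in> \<xi>"
      using cancel(1)[of h] assms(3) by auto
  next
    assume "inv\<^bsub>G\<^esub> g \<otimes>\<^bsub>G\<^esub> k \<in> \<xi>"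
    then have "g \<otimes>\<^bsub>G\<^esub> (inv\<^bsub>G\<^esub> g \<otimes>\<^bsub>G\<^esub> k) \<in> spectral_map G g \<xi>"
      by (auto simp: spectral_map_def l_coset_def)
    then show "k \<in> spectral_map G g \<xi>"
      using cancel(2)[OF assms(4)] by simp
  qed
qed

lemma spectral_map_mult:
  assumes "group G" "g \<in> carrier G" "h \<in> carrier G" "\<xi> \<subseteq> carrier G"
  shows "spectral_map G g (spectral_map G h \<xi>) = spectral_map G (g \<otimes>\<^bsub>G\<^esub> h) \<xi>"
  using assms group.lcos_m_assoc[of G \<xi> g h] by (simp add: spectral_map_def)

lemma spectral_map_one:
  assumes "group G" "\<xi> \<subseteq> carrier G"
  shows "spectral_map G \<one>\<^bsub>G\<^esub> \<xi> = \<xi>"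
  using assms group.lcos_mult_one[of G \<xi>] by (simp add: spectral_map_def)

lemma spectral_map_subset:
  assumes "group G" "g \<in> carrier G" "\<xi> \<subseteq> carrier G"
  shows "spectral_map G g \<xi> \<subseteq> carrier G"
  using assms group.l_coset_subset_G[of G \<xi> g] by (simp add: spectral_map_def)

lemma prohibitions_translate:
  assumes "group G" "g \<in> carrier G" "V \<in> prohibitions G K \<sigma>"
  shows "spectral_map G g V \<in> prohibitions G K \<sigma>" "V \<subseteq> carrier G"
proof -
  interpret group G by fact
  have "spectral_map G g V \<in> prohibitions_I G K \<sigma>" if V: "V \<in> prohibitions_I G K \<sigma>"
  proof -
    obtain h a s where *: "V = {h, h \<otimes>\<^bsub>G\<^esub> a, h \<otimes>\<^bsub>G\<^esub> a \<otimes>\<^bsub>G\<^esub> s}"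
      "h \<in> carrier G" "a \<in> carrier G" "s \<in> carrier G" "\<sigma> a s = \<zero>\<^bsub>K\<^esub>"
      using V unfolding prohibitions_I_def by blast
    have "spectral_map G g V = {g \<otimes>\<^bsub>G\<^esub> h, g \<otimes>\<^bsub>G\<^esub> h \<otimes>\<^bsub>G\<^esub> a, g \<otimes>\<^bsub>G\<^esub> h \<otimes>\<^bsub>G\<^esub> a \<otimes>\<^bsub>G\<^esub> s}"
      using * assms(2) by (auto simp: spectral_map_def l_coset_def m_assoc)
    then show ?thesis
      unfolding prohibitions_I_def
      by (intro CollectI exI conjI, assumption) (use *(2-) assms(2) in simp_all)
  qed
  moreover have "spectral_map G g V \<in> prohibitions_II G K \<sigma>" if V: "V \<in> prohibitions_II G K \<sigma>"
  proof -
    obtain h a s t where *: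
      "V = {h, h \<otimes>\<^bsub>G\<^esub> a, h \<otimes>\<^bsub>G\<^esub> a \<otimes>\<^bsub>G\<^esub> s, h \<otimes>\<^bsub>G\<^esub> a \<otimes>\<^bsub>G\<^esub> s \<otimes>\<^bsub>G\<^esub> t}"
      "h \<in> carrier G" "a \<in> carrier G" "s \<in> carrier G" "t \<in> carrier G"
      "\<sigma> a (s \<otimes>\<^bsub>G\<^esub> t) \<otimes>\<^bsub>K\<^esub> \<sigma> s t \<noteq> \<sigma> a s \<otimes>\<^bsub>K\<^esub> \<sigma> (a \<otimes>\<^bsub>G\<^esub> s) t"
      using V unfolding prohibitions_II_def by blast
    have "spectral_map G g V = {g \<otimes>\<^bsub>G\<^esub> h, g \<otimes>\<^bsub>G\<^esub> h \<otimes>\<^bsub>G\<^esub> a, g \<otimes>\<^bsub>G\<^esub> h \<otimes>\<^bsub>G\<^esub> a \<otimes>\<^bsub>G\<^esub> s,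
        g \<otimes>\<^bsub>G\<^esub> h \<otimes>\<^bsub>G\<^esub> a \<otimes>\<^bsub>G\<^esub> s \<otimes>\<^bsub>G\<^esub> t}"
      using * assms(2) by (auto simp: spectral_map_def l_coset_def m_assoc)
    then show ?thesis
      unfolding prohibitions_II_def
      by (intro CollectI exI conjI, assumption) (use *(2-) assms(2) in simp_all)
  qed
  ultimately show "spectral_map G g V \<in> prohibitions G K \<sigma>"
    using assms(3) by (auto simp: prohibitions_def)
  show "V \<subseteq> carrier G"
    using assms(3) by (auto simp: prohibitions_def prohibitions_I_def prohibitions_II_def)
qed

lemma spectral_map_in_domain:
  assumes "group G" "g \<in> carrier G" "\<xi> \<in> spectral_domain G K \<sigma> (inv\<^bsub>G\<^esub> g)"
  shows "spectral_map G g \<xi> \<in> spectral_domain G K \<sigma> g"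
proof -
  interpret group G by fact
  have \<xi>: "\<xi> \<subseteq> carrier G" "\<one>\<^bsub>G\<^esub> \<in> \<xi>" "inv\<^bsub>G\<^esub> g \<in> \<xi>"
    and P: "\<And>V. V \<in> prohibitions G K \<sigma> \<Longrightarrow> \<not> V \<subseteq> \<xi>"
    using assms(3) by (auto simp: spectral_domain_def Omega_sigma_def Omega_def)
  have "\<not> V \<subseteq> spectral_map G g \<xi>" if V: "V \<in> prohibitions G K \<sigma>" for V
  proof
    assume "V \<subseteq> spectral_map G g \<xi>"
    then have "spectral_map G (inv\<^bsub>G\<^esub> g) V \<subseteq> spectral_map G (inv\<^bsub>G\<^esub> g) (spectral_map G g \<xi>)"
      by (auto simp: spectral_map_def l_coset_def)
    also have "\<dots> = \<xi>"
      using assms \<xi> by (simp add: spectral_map_mult spectral_map_one)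
    finally show False
      using P prohibitions_translate(1)[OF assms(1) _ V, of "inv\<^bsub>G\<^esub> g"] assms(2) by auto
  qed
  then show ?thesis
    using assms(1,2) \<xi> spectral_map_subset[OF assms(1,2) \<xi>(1)]
    by (auto simp: spectral_domain_def Omega_sigma_def Omega_def mem_spectral_map)
qed

lemma spectral_partial_action:
  assumes "group G"
  shows "topological_partial_action G (Omega_sigma_topology G K \<sigma>)
           (spectral_domain G K \<sigma>) (spectral_map G)"
proof -
  interpret group G by fact
  let ?X = "Omega_sigma_topology G K \<sigma>"
  let ?D = "spectral_domain G K \<sigma>"
  have D_sub: "?D g \<subseteq> Omega_sigma G K \<sigma>" for g
    by (auto simp: spectral_domain_def)
  have sub: "\<xi> \<subseteq> carrier G" if "\<xi> \<in> ?D g" for \<xi> g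
    using that by (auto simp: spectral_domain_def Omega_sigma_def Omega_def)
  have mem_cont: "continuous_map ?X (discrete_topology (UNIV :: bool set)) (\<lambda>\<xi>. x \<in> \<xi>)"
    if "x \<in> carrier G" for x
    unfolding Omega_sigma_topology_def
    by (intro continuous_map_from_subtopology continuous_map_mem_Omega that)
  have op: "openin ?X (?D g)" if "g \<in> carrier G" for g
  proof -
    have "openin ?X {\<xi> \<in> topspace ?X. (g \<in> \<xi>) \<in> {True}}"
      using mem_cont[OF that] by (rule openin_continuous_map_preimage) simp
    then show ?thesis
      by (simp add: topspace_Omega_sigma_topology spectral_domain_def)
  qed
  have top_D: "topspace (subtopology ?X (?D g)) = ?D g" for g
    using D_sub by (auto simp: topspace_Omega_sigma_topology)
  have into: "spectral_map G g \<xi> \<in> ?D g" if "g \<in> carrier G" "\<xi> \<in> ?D (inv\<^bsub>G\<^esub> g)" for g \<xi>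
    using spectral_map_in_domain[OF assms that] .
  have cont: "continuous_map (subtopology ?X (?D (inv\<^bsub>G\<^esub> g))) (subtopology ?X (?D g)) (spectral_map G g)"
    if g: "g \<in> carrier G" for g
  proof -
    let ?I = "carrier G - {\<one>\<^bsub>G\<^esub>}"
    let ?Y = "subtopology ?X (?D (inv\<^bsub>G\<^esub> g))"
    have comp: "continuous_map ?Y (discrete_topology (UNIV :: bool set)) (\<lambda>\<xi>. k \<in> spectral_map G g \<xi>)"
      if k: "k \<in> carrier G" for k
    proof (rule continuous_map_eq)
      show "continuous_map ?Y (discrete_topology (UNIV :: bool set)) (\<lambda>\<xi>. inv\<^bsub>G\<^esub> g \<otimes>\<^bsub>G\<^esub> k \<in> \<xi>)"
        using g k by (intro continuous_map_from_subtopology mem_cont) auto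
      show "(inv\<^bsub>G\<^esub> g \<otimes>\<^bsub>G\<^esub> k \<in> \<xi>) = (k \<in> spectral_map G g \<xi>)" if "\<xi> \<in> topspace ?Y" for \<xi>
        using mem_spectral_map[OF assms g sub k] that unfolding top_D by simp
    qed
    have "continuous_map ?Y (Omega_topology G) (spectral_map G g)"
      unfolding Omega_topology_def
    proof (rule continuous_map_pullback')
      show "continuous_map ?Y (product_topology (\<lambda>_. discrete_topology (UNIV :: bool set)) ?I)
          ((\<lambda>\<xi>. \<lambda>k\<in>?I. k \<in> \<xi>) \<circ> spectral_map G g)"
        using comp by (auto simp: continuous_map_componentwise comp_def)
      show "topspace ?Y \<subseteq> spectral_map G g -` Omega G"
        using into[OF g] unfolding top_D by (auto simp: spectral_domain_def Omega_sigma_def)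
    qed
    then show ?thesis
      using into[OF g] D_sub unfolding Omega_sigma_topology_def
      by (auto simp: continuous_map_in_subtopology spectral_domain_def
          topspace_Omega_topology image_subset_iff)
  qed
  have hom: "homeomorphic_map (subtopology ?X (?D (inv\<^bsub>G\<^esub> g))) (subtopology ?X (?D g)) (spectral_map G g)"
    if g: "g \<in> carrier G" for g
  proof -
    have "homeomorphic_maps (subtopology ?X (?D (inv\<^bsub>G\<^esub> g))) (subtopology ?X (?D g))
        (spectral_map G g) (spectral_map G (inv\<^bsub>G\<^esub> g))"
      unfolding homeomorphic_maps_def top_D
      using cont[OF g] cont[of "inv\<^bsub>G\<^esub> g"] g
      by (simp add: spectral_map_mult[OF assms] spectral_map_one[OF assms] sub)
    then show ?thesis
      using homeomorphic_maps_map by blast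
  qed
  have mult: "x \<in> ?D (inv\<^bsub>G\<^esub> (g \<otimes>\<^bsub>G\<^esub> h)) \<and>
      spectral_map G (g \<otimes>\<^bsub>G\<^esub> h) x = spectral_map G g (spectral_map G h x)"
    if "g \<in> carrier G" "h \<in> carrier G" "x \<in> ?D (inv\<^bsub>G\<^esub> h)" "spectral_map G h x \<in> ?D (inv\<^bsub>G\<^esub> g)"
    for g h x
  proof -
    have "inv\<^bsub>G\<^esub> h \<otimes>\<^bsub>G\<^esub> inv\<^bsub>G\<^esub> g \<in> x"
      using that mem_spectral_map[OF assms that(2) sub[OF that(3)], of "inv\<^bsub>G\<^esub> g"]
      by (simp add: spectral_domain_def)
    then show ?thesis
      using that spectral_map_mult[OF assms that(1,2) sub[OF that(3)]]
      by (simp add: spectral_domain_def inv_mult_group)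
  qed
  show ?thesis
    unfolding topological_partial_action_def
  proof (intro conjI ballI impI)
    show D_one: "?D \<one>\<^bsub>G\<^esub> = topspace ?X"
      by (auto simp: topspace_Omega_sigma_topology spectral_domain_def Omega_sigma_def Omega_def)
    show "spectral_map G \<one>\<^bsub>G\<^esub> x = x" if "x \<in> topspace ?X" for x
      using that sub unfolding D_one[symmetric] by (simp add: spectral_map_one[OF assms])
  qed (use op hom mult in simp_all)
qed

end

theory Submission
  imports Defs
begin

text \<open>
  Since \<open>\<sigma>\<^sub>W\<close> only takes the values \<open>0\<close> and \<open>1\<close>, every prohibition of type II contains one of
  type I, so \<open>\<Omega>\<^sub>\<sigma>\<close> consists of the sets \<open>\<xi>\<close> containing \<open>1\<close> such that
  \<open>(x\<inverse>y, y\<inverse>z) \<notin> W\<close> for all \<open>x, y, z \<in> \<xi>\<close>. A basic neighbourhood of \<open>\<xi>\<close> is determined by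
  a finite \<open>F \<subseteq> G\<close> with \<open>1 \<in> F\<close> and contains the finite set \<open>A = \<xi> \<inter> F\<close>. Adding \<open>g\<close> to \<open>A\<close> leaves
  \<open>\<Omega>\<^sub>\<sigma>\<close> only if \<open>g\<close> is one of \<open>xb\<close>, \<open>xa\<close>, \<open>xa\<inverse>\<close> with \<open>x \<in> A\<close> and \<open>(a, b) \<in> W\<close>. There are
  fewer than \<open>|G|\<close> such elements, so the neighbourhood contains both \<open>A\<close> and some
  \<open>A \<union> {g}\<close> with \<open>g \<notin> A\<close>. A translation fixing both sets fixes \<open>g\<close>, hence is trivial.
\<close>

section \<open>Sets smaller than an infinite set\<close>

lemma lesspoll_iff_not_lepoll: "A \<prec> B \<longleftrightarrow> \<not> B \<lesssim> A"
proof
  show "A \<prec> B \<Longrightarrow> \<not> B \<lesssim> A"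
    by (auto simp: lesspoll_def intro: lepoll_antisym)
  \<comment> \<open>Cardinals are linearly ordered, so the absence of an injection one way yields
    one the other way.\<close>
  assume *: "\<not> B \<lesssim> A"
  then have "A \<lesssim> B"
    unfolding lepoll_def using ordLess_imp_ordLeq card_of_ordLess card_of_ordLeq by blast
  with * show "A \<prec> B"
    by (auto simp: lesspoll_def dest: eqpoll_sym eqpoll_imp_lepoll)
qed

lemma Un_lesspoll_infinite:
  assumes "infinite C" "A \<prec> C" "B \<prec> C"
  shows "A \<union> B \<prec> C"
  using card_of_Un_ordLess_infinite[OF assms(1), of A B] assms(2,3)
  unfolding lesspoll_iff_not_lepoll lepoll_def card_of_ordLess by blast

lemma UN_lesspoll_infinite:
  assumes "finite I" "infinite C" "\<And>i. i \<in> I \<Longrightarrow> f i \<prec> C"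
  shows "(\<Union>i\<in>I. f i) \<prec> C"
  using assms(1,3)
proof (induction rule: finite_induct)
  case empty
  then show ?case
    using finite_lesspoll_infinite[OF assms(2) finite.emptyI] by simp
next
  case (insert i I)
  then show ?case
    by (simp add: Un_lesspoll_infinite assms(2))
qed

lemma image_lesspoll: "A \<prec> C \<Longrightarrow> f ` A \<prec> C"
  using image_lepoll lesspoll_trans1 by blast

section \<open>Basic neighbourhoods in the spectrum\<close>

lemma openin_Omega_sigma_topologyE:
  assumes "openin (Omega_sigma_topology G K \<sigma>) U" "\<xi> \<in> U"
  obtains F where "finite F"
    "\<And>\<eta>. \<eta> \<in> Omega_sigma G K \<sigma> \<Longrightarrow> \<eta> \<inter> F = \<xi> \<inter> F \<Longrightarrow> \<eta> \<in> U"
proof -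
  let ?I = "carrier G - {\<one>\<^bsub>G\<^esub>}"
  let ?f = "\<lambda>\<xi>. \<lambda>g\<in>?I. g \<in> \<xi>"
  obtain T where T: "openin (product_topology (\<lambda>_. discrete_topology (UNIV :: bool set)) ?I) T"
    and U: "U = ?f -` T \<inter> Omega G \<inter> Omega_sigma G K \<sigma>"
    using assms(1)
    unfolding Omega_sigma_topology_def Omega_topology_def openin_subtopology
      openin_pullback_topology by blast
  have "?f \<xi> \<in> T"
    using assms(2) U by auto
  then obtain V where V: "finite {i \<in> ?I. V i \<noteq> UNIV}" "?f \<xi> \<in> Pi\<^sub>E ?I V" "Pi\<^sub>E ?I V \<subseteq> T"
    using T unfolding openin_product_topology_alt topspace_discrete_topology by meson
  \<comment> \<open>\<open>F\<close> is the set of coordinates at which the basic box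
    \<open>Pi\<^sub>E ?I V\<close> is a proper restriction; equal traces on \<open>F\<close> mean
    equal values there.\<close>
  show ?thesis
  proof
    fix \<eta> assume \<eta>: "\<eta> \<in> Omega_sigma G K \<sigma>"
      and eq: "\<eta> \<inter> {i \<in> ?I. V i \<noteq> UNIV} = \<xi> \<inter> {i \<in> ?I. V i \<noteq> UNIV}"
    have "(i \<in> \<eta>) \<in> V i" if i: "i \<in> ?I" for i
    proof (cases "V i = UNIV")
      case False
      then have "(i \<in> \<eta>) = (i \<in> \<xi>)"
        using eq i by blast
      then show ?thesis
        using PiE_mem[OF V(2) i] i by simp
    qed simp
    then have "?f \<eta> \<in> Pi\<^sub>E ?I V"
      by auto
    with \<eta> V(3) show "\<eta> \<in> U"
      unfolding U Omega_sigma_def by blast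
  qed (fact V(1))
qed

section \<open>The spectrum of a lateral factor set\<close>

text \<open>The six pairs are the consecutive quotients of the six orderings of
  \<open>x, y, z\<close>, so the class depends only on the set of these three points.\<close>

lemma (in group) lateral_class_triple:
  assumes "x \<in> carrier G" "y \<in> carrier G" "z \<in> carrier G"
  shows "lateral_class G (inv x \<otimes> y) (inv y \<otimes> z) =
    {(inv x \<otimes> y, inv y \<otimes> z), (inv z \<otimes> x, inv x \<otimes> y), (inv y \<otimes> z, inv z \<otimes> x),
     (inv z \<otimes> y, inv y \<otimes> x), (inv y \<otimes> x, inv x \<otimes> z), (inv x \<otimes> z, inv z \<otimes> y)}"
proof -
  have cancel: "a \<otimes> (inv a \<otimes> b) = b" if "a \<in> carrier G" "b \<in> carrier G" for a b
    using that by (simp flip: m_assoc)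
  show ?thesis
    using assms by (simp add: lateral_class_def inv_mult_group m_assoc cancel)
qed

text \<open>The quantifiers run over all orderings of a triple in \<xi>, so excluding one pair for
  each ordering keeps the whole lateral class of the triple off \<open>W\<close>.\<close>

lemma mem_Omega_sigma_lateral_iff:
  fixes G (structure)
  assumes "field K" "group G"
  shows "\<xi> \<in> Omega_sigma G K (lateral_factor_set G K W) \<longleftrightarrow>
    \<xi> \<in> Omega G \<and> (\<forall>x\<in>\<xi>. \<forall>y\<in>\<xi>. \<forall>z\<in>\<xi>. (inv x \<otimes> y, inv y \<otimes> z) \<notin> W)"
    (is "_ \<longleftrightarrow> _ \<and> ?R")
proof -
  interpret K: field K by fact
  interpret group G by fact
  let ?\<sigma> = "lateral_factor_set G K W"
  have cancel: "inv a \<otimes> (a \<otimes> b) = b" "a \<otimes> (inv a \<otimes> b) = b"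
    if "a \<in> carrier G" "b \<in> carrier G" for a b
    using that by (simp_all flip: m_assoc)
  have one: "?\<sigma> a b = \<one>\<^bsub>K\<^esub>"
    if R: ?R and \<xi>: "\<xi> \<subseteq> carrier G" and ab: "a \<in> carrier G" "b \<in> carrier G"
      and h: "h \<in> \<xi>" "h \<otimes> a \<in> \<xi>" "h \<otimes> a \<otimes> b \<in> \<xi>" for a b h
  proof -
    have hc: "h \<in> carrier G"
      using h \<xi> by blast
    have "lateral_class G (inv h \<otimes> (h \<otimes> a)) (inv (h \<otimes> a) \<otimes> (h \<otimes> a \<otimes> b)) \<inter> W = {}"
      using R h ab hc by (subst lateral_class_triple) auto
    then show ?thesis
      using ab hc by (simp add: cancel lateral_factor_set_def)
  qed
  have "\<not> V \<subseteq> \<xi>" if R: ?R and \<xi>: "\<xi> \<subseteq> carrier G" and V: "V \<in> prohibitions G K ?\<sigma>" for V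
  proof
    assume sub: "V \<subseteq> \<xi>"
    note one = one[OF R \<xi>]
    from V consider "V \<in> prohibitions_I G K ?\<sigma>" | "V \<in> prohibitions_II G K ?\<sigma>"
      by (auto simp: prohibitions_def)
    then show False
    proof cases
      case 1
      then obtain h g s where "V = {h, h \<otimes> g, h \<otimes> g \<otimes> s}"
        "g \<in> carrier G" "s \<in> carrier G" "?\<sigma> g s = \<zero>\<^bsub>K\<^esub>"
        unfolding prohibitions_I_def by blast
      then show False
        using one[of g s h] sub by simp
    next
      case 2
      then obtain h g s t where V: "V = {h, h \<otimes> g, h \<otimes> g \<otimes> s, h \<otimes> g \<otimes> s \<otimes> t}"
        and c: "h \<in> carrier G" "g \<in> carrier G" "s \<in> carrier G" "t \<in> carrier G"
        and ne: "?\<sigma> g (s \<otimes> t) \<otimes>\<^bsub>K\<^esub> ?\<sigma> s t \<noteq> ?\<sigma> g s \<otimes>\<^bsub>K\<^esub> ?\<sigma> (g \<otimes> s) t"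
        unfolding prohibitions_II_def by blast
      \<comment> \<open>The four factors belong to the four triples obtained by dropping one of the
        points \<open>h\<close>, \<open>hg\<close>, \<open>hgs\<close>, \<open>hgst\<close>.\<close>
      have "?\<sigma> g (s \<otimes> t) = \<one>\<^bsub>K\<^esub>" "?\<sigma> s t = \<one>\<^bsub>K\<^esub>" "?\<sigma> g s = \<one>\<^bsub>K\<^esub>" "?\<sigma> (g \<otimes> s) t = \<one>\<^bsub>K\<^esub>"
        using one[of g "s \<otimes> t" h] one[of s t "h \<otimes> g"] one[of g s h] one[of "g \<otimes> s" t h] V sub c
        by (auto simp: m_assoc)
      with ne show False
        by simp
    qed
  qed
  moreover have ?R if \<xi>: "\<xi> \<in> Omega_sigma G K ?\<sigma>"
  proof (intro ballI notI)
    fix x y z assume m: "x \<in> \<xi>" "y \<in> \<xi>" "z \<in> \<xi>" and W: "(inv x \<otimes> y, inv y \<otimes> z) \<in> W"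
    have c: "x \<in> carrier G" "y \<in> carrier G" "z \<in> carrier G"
      using m \<xi> by (auto simp: Omega_sigma_def Omega_def)
    have "?\<sigma> (inv x \<otimes> y) (inv y \<otimes> z) = \<zero>\<^bsub>K\<^esub>"
      using W by (auto simp: lateral_factor_set_def lateral_class_def)
    moreover have "{x, y, z} = {x, x \<otimes> (inv x \<otimes> y), x \<otimes> (inv x \<otimes> y) \<otimes> (inv y \<otimes> z)}"
      using c by (simp add: cancel)
    ultimately have "{x, y, z} \<in> prohibitions_I G K ?\<sigma>"
      unfolding prohibitions_I_def using c m_closed inv_closed by blast
    then have "\<not> {x, y, z} \<subseteq> \<xi>"
      using \<xi> unfolding Omega_sigma_def prohibitions_def by blast
    with m show False
      by simp
  qed
  ultimately show ?thesis
    by (auto simp: Omega_sigma_def Omega_def)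
qed

text \<open>A violating triple has three distinct points, one of them \<open>g\<close>. With
  \<open>(a, b)\<close> the resulting pair in \<open>W\<close>, solving for \<open>g\<close> in
  first, second or third position gives \<open>g\<close> as an element of \<open>A\<close> times
  \<open>inv a\<close>, \<open>a\<close> or \<open>b\<close>.\<close>

lemma insert_mem_Omega_sigma_lateral:
  fixes G (structure)
  assumes "field K" "group G"
    and W: "W \<subseteq> carrier G \<times> carrier G"
      "\<forall>z \<in> carrier G. lateral_class G z (inv z) \<inter> W = {}"
    and A: "A \<in> Omega_sigma G K (lateral_factor_set G K W)"
    and g: "g \<in> carrier G"
      "\<And>x a b. x \<in> A \<Longrightarrow> (a, b) \<in> W \<Longrightarrow> g \<noteq> x \<otimes> a \<and> g \<noteq> x \<otimes> b \<and> g \<noteq> x \<otimes> inv a"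
  shows "insert g A \<in> Omega_sigma G K (lateral_factor_set G K W)"
proof -
  interpret group G by fact
  have cancel: "a \<otimes> (inv a \<otimes> b) = b" if "a \<in> carrier G" "b \<in> carrier G" for a b
    using that by (simp flip: m_assoc)
  have Ac: "A \<subseteq> carrier G"
    and R: "\<And>x y z. x \<in> A \<Longrightarrow> y \<in> A \<Longrightarrow> z \<in> A \<Longrightarrow> (inv x \<otimes> y, inv y \<otimes> z) \<notin> W"
    using A by (auto simp: mem_Omega_sigma_lateral_iff[OF assms(1,2)] Omega_def)
  have degenerate: "(inv x \<otimes> y, inv y \<otimes> z) \<notin> W"
    if "x = y \<or> y = z \<or> x = z" "x \<in> carrier G" "y \<in> carrier G" "z \<in> carrier G" for x y z
  proof -
    \<comment> \<open>Triples with a repetition give only pairs of these three shapes, which lie in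
      the classes of \<open>(z, inv z)\<close> and \<open>(inv z, z)\<close>.\<close>
    have "(z, inv z) \<notin> W" "(\<one>, z) \<notin> W" "(z, \<one>) \<notin> W" if "z \<in> carrier G" for z
      using bspec[OF W(2), of z] bspec[OF W(2), of "inv z"] that by (auto simp: lateral_class_def)
    from this[of "inv x \<otimes> y"] this[of "inv y \<otimes> z"] that show ?thesis
      by (auto simp: inv_mult_group)
  qed
  have "(inv x \<otimes> y, inv y \<otimes> z) \<notin> W"
    if ins: "x \<in> insert g A" "y \<in> insert g A" "z \<in> insert g A" for x y z
  proof
    assume w: "(inv x \<otimes> y, inv y \<otimes> z) \<in> W"
    have c: "x \<in> carrier G" "y \<in> carrier G" "z \<in> carrier G"
      using ins Ac g(1) by auto
    then have d: "x \<noteq> y" "y \<noteq> z" "x \<noteq> z"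
      using w degenerate by auto
    consider "x \<in> A" "y \<in> A" "z \<in> A" | "x = g" "y \<in> A" | "y = g" "x \<in> A" | "z = g" "y \<in> A"
      using ins d by fast
    then show False
    proof cases
      case 1
      then show False using R w by blast
    next
      case 2
      then show False
        using g(2)[OF _ w, of y] c by (simp add: inv_mult_group cancel)
    next
      case 3
      then show False
        using g(2)[OF _ w, of x] c by (simp add: cancel)
    next
      case 4
      then show False
        using g(2)[OF _ w, of y] c by (simp add: cancel)
    qed
  qed
  then show ?thesis
    using A g(1) by (auto simp: mem_Omega_sigma_lateral_iff[OF assms(1,2)] Omega_def)
qed

section \<open>No isolated points and topological freeness\<close>

lemma Omega_sigma_lateral_neighbourhood:
  fixes G (structure)
  assumes "field K" "group G" "infinite (carrier G)"
    and W: "W \<subseteq> carrier G \<times> carrier G"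
      "\<forall>z \<in> carrier G. lateral_class G z (inv z) \<inter> W = {}" "W \<prec> carrier G"
    and U: "openin (Omega_sigma_topology G K (lateral_factor_set G K W)) U" "U \<noteq> {}"
  obtains A g where "A \<in> U" "insert g A \<in> U" "g \<notin> A" "g \<in> carrier G" "A \<subseteq> carrier G"
proof -
  interpret group G by fact
  let ?S = "Omega_sigma G K (lateral_factor_set G K W)"
  obtain \<xi> where \<xi>: "\<xi> \<in> U"
    using U(2) by blast
  then have \<xi>S: "\<xi> \<in> ?S"
    using openin_subset[OF U(1)] by (auto simp: topspace_Omega_sigma_topology)
  obtain F where F: "finite F" "\<And>\<eta>. \<eta> \<in> ?S \<Longrightarrow> \<eta> \<inter> F = \<xi> \<inter> F \<Longrightarrow> \<eta> \<in> U"
    using openin_Omega_sigma_topologyE[OF U(1) \<xi>] by blast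
  \<comment> \<open>The unit is added because \<open>F\<close> need not contain it and
    \<open>A\<close> must lie in \<open>Omega G\<close>.\<close>
  define A where "A = \<xi> \<inter> insert \<one> F"
  have fin: "finite A"
    using F(1) by (simp add: A_def)
  have "A \<subseteq> \<xi>" "\<one> \<in> A"
    using \<xi>S by (auto simp: A_def Omega_sigma_def Omega_def)
  \<comment> \<open>A subset of \<xi> contains no prohibition either.\<close>
  then have AS: "A \<in> ?S" and Ac: "A \<subseteq> carrier G"
    using \<xi>S unfolding Omega_sigma_def Omega_def by blast+
  \<comment> \<open>These are the values of \<open>g\<close> that the insertion lemma rules out:
    finitely many images of \<open>W\<close>.\<close>
  let ?B = "\<Union>x\<in>A. (\<lambda>(a, b). x \<otimes> a) ` W \<union> (\<lambda>(a, b). x \<otimes> b) ` W \<union> (\<lambda>(a, b). x \<otimes> inv a) ` W"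
  have "?B \<prec> carrier G"
    by (intro UN_lesspoll_infinite Un_lesspoll_infinite image_lesspoll fin assms(3) W(3))
  moreover have "A \<union> F \<prec> carrier G"
    using fin F(1) assms(3) by (simp add: finite_lesspoll_infinite)
  ultimately have "?B \<union> (A \<union> F) \<prec> carrier G"
    by (rule Un_lesspoll_infinite[OF assms(3)])
  then have "\<not> carrier G \<subseteq> ?B \<union> (A \<union> F)"
    using subset_imp_lepoll lesspoll_iff_not_lepoll by blast
  \<comment> \<open>Avoiding \<open>F\<close> keeps the trace on \<open>F\<close>, hence membership
    in \<open>U\<close>, unchanged.\<close>
  then obtain g where g: "g \<in> carrier G" "g \<notin> ?B" "g \<notin> A" "g \<notin> F"
    by blast
  have "insert g A \<in> ?S"
  proof (rule insert_mem_Omega_sigma_lateral[OF assms(1,2) W(1,2) AS g(1)])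
    show "g \<noteq> x \<otimes> a \<and> g \<noteq> x \<otimes> b \<and> g \<noteq> x \<otimes> inv a" if "x \<in> A" "(a, b) \<in> W" for x a b
      using g(2) that by force
  qed
  moreover have "A \<inter> F = \<xi> \<inter> F" "insert g A \<inter> F = \<xi> \<inter> F"
    using g(4) by (auto simp: A_def)
  ultimately show ?thesis
    using that F(2) AS g Ac by blast
qed

theorem proposition9p9:
  fixes G :: "('a, 'm) monoid_scheme"
    and K :: "('k, 'n) ring_scheme"
    and W :: "('a \<times> 'a) set"
  assumes "field K"
    and "group G"
    and "infinite (carrier G)"
    and "\<exists>g \<in> carrier G. g \<noteq> \<one>\<^bsub>G\<^esub> \<and> (\<exists>n::nat. n > 0 \<and> g [^]\<^bsub>G\<^esub> n = \<one>\<^bsub>G\<^esub>)"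
    and "W \<subseteq> carrier G \<times> carrier G"
    and "\<forall>z \<in> carrier G. lateral_class G z (inv\<^bsub>G\<^esub> z) \<inter> W = {}"
    and "W \<prec> carrier G"
  shows "(\<forall>\<xi> \<in> topspace (Omega_sigma_topology G K (lateral_factor_set G K W)).
            \<not> openin (Omega_sigma_topology G K (lateral_factor_set G K W)) {\<xi>}) \<and>
         topologically_free G
           (Omega_sigma_topology G K (lateral_factor_set G K W))
           (spectral_domain G K (lateral_factor_set G K W))
           (spectral_map G)"
proof -
  interpret group G by fact
  let ?\<sigma> = "lateral_factor_set G K W"
  let ?X = "Omega_sigma_topology G K ?\<sigma>"
  note nbhd = Omega_sigma_lateral_neighbourhood[OF assms(1,2,3,5) assms(6,7)]
  have "\<not> openin ?X {\<xi>}" for \<xi>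
    proof
    assume "openin ?X {\<xi>}"
    from nbhd[OF this insert_not_empty]
    obtain A k where "A \<in> {\<xi>}" "insert k A \<in> {\<xi>}" "k \<notin> A" .
    then show False
      by auto
  qed
  moreover have "?X interior_of {\<xi> \<in> spectral_domain G K ?\<sigma> (inv\<^bsub>G\<^esub> g). spectral_map G g \<xi> = \<xi>} = {}"
    (is "?U = {}") if g: "g \<in> carrier G" "g \<noteq> \<one>\<^bsub>G\<^esub>" for g
  proof (rule ccontr)
    assume "?U \<noteq> {}"
    then obtain A k where Ak: "A \<in> ?U" "insert k A \<in> ?U" "k \<notin> A" "k \<in> carrier G" "A \<subseteq> carrier G"
      by (rule nbhd[OF openin_interior_of])
    have fixed: "spectral_map G g A = A" "spectral_map G g (insert k A) = insert k A"
      using Ak(1,2) interior_of_subset by fastforce+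
    have gk: "g \<otimes>\<^bsub>G\<^esub> k \<in> carrier G" "inv\<^bsub>G\<^esub> g \<otimes>\<^bsub>G\<^esub> (g \<otimes>\<^bsub>G\<^esub> k) = k"
      using g Ak(4) by (simp_all flip: m_assoc)
    \<comment> \<open>Translation by \<open>g\<close> preserves both sets, hence also their
      difference, the singleton of \<open>k\<close>.\<close>
    have "g \<otimes>\<^bsub>G\<^esub> k \<notin> A" "g \<otimes>\<^bsub>G\<^esub> k \<in> insert k A"
      using mem_spectral_map[OF assms(2) g(1) _ gk(1), of A]
        mem_spectral_map[OF assms(2) g(1) _ gk(1), of "insert k A"] fixed gk(2) Ak(3-5) by auto
    then have "g \<otimes>\<^bsub>G\<^esub> k = k"
      by simp
    then show False
      using g Ak(4) by simp
  qed
  ultimately show ?thesis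
    by (auto simp: topologically_free_def)
qed

end
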